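(* Let $S,M,P$ be term-variables, and let $S,M,P$ also denote three distinct atomic formulas of $\mathrm{RLL}^{\bot}$, all different from $\bot$. For every traditional syllogism $P_1,P_2\therefore C$ and every traditional strengthened syllogism $P_1,P_2,\mathbf{I}_{XX}\therefore C$ (with $X\in\{S,M,P\}$), the argument is valid if and only if the corresponding sequent $P_1^{*},P_2^{*}\vdash C^{*}$ (respectively $P_1^{*},P_2^{*},X\otimes X\vdash C^{*}$) is provable in $\mathrm{RLL}^{\bot}$.
   Context: The system $\mathrm{RLL}^{\bot}$ (intuitionistic rudimentary linear logic with an extra atom). Formulas are built from atomic formulas, among which is a distinguished atom $\bot$, by the grammar $A::=\alpha\mid A\otimes A\mid A\multimap A$. A sequent is $\Gamma\vdash A$ with $\Gamma$ a finite multiset of formulas. The rules are exactly: (Id) $A\vdash A$; ($\otimes$L) from $\Gamma,A,B\vdash C$ infer $\Gamma,A\otimes B\vdash C$; ($\otimes$R) from $\Gamma\vdash A$ and $\Delta\vdash B$ infer $\Gamma,\Delta\vdash A\otimes B$; ($\multimap$L) from $\Gamma\vdash A$ and $\Delta,B\vdash C$ infer $\Gamma,\Delta,A\multimap B\vdash C$; ($\multimap$R) from $\Gamma,A\vdash B$ infer $\Gamma\vdash A\multimap B$. There is no cut rule, no weakening and no contraction; $\bot$ has no rules of its own. A sequent is provable if it is the root of a finite tree of instances of these rules whose leaves are instances of (Id). $A^{\bot}$ abbreviates $A\multimap\bot$. Traditional syllogistics. Term-variables are upper-case letters; the lower-case letter denotes the complement (e.g. $b$ means non-$B$). For upper-case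 $A,B$ the categorical propositions are $\mathbf{A}_{AB}$ ``Each $A$ is $B$'', $\mathbf{A}_{Ab}$ ``Each $A$ is non-$B$'', $\mathbf{I}_{AB}$ ``Some $A$ is $B$'', $\mathbf{I}_{Ab}$ ``Some $A$ is non-$B$'' ($A$ is the subject, $B$ the predicate). A traditional syllogism is an argument $P_1,P_2\therefore C$ (first premise, second premise, conclusion) of categorical propositions involving the term-variables $S,M,P$ such that $M$ occurs in both premises and not in the conclusion, $P$ occurs in $P_1$, $S$ occurs in $P_2$, and $C$ has subject $S$ and predicate $P$ (possibly as $p$). A traditional strengthened syllogism is $P_1,P_2,\mathbf{I}_{XX}\therefore C$ with $P_1,P_2\therefore C$ a traditional syllogism and $X\in\{S,M,P\}$ ($\mathbf{I}_{XX}$ expressing existential import on $X$). The valid ones are exactly those listed as follows. Syllogisms: $\mathbf{A}_{MP},\mathbf{A}_{SM}\therefore\mathbf{A}_{SP}$; $\mathbf{A}_{Mp},\mathbf{A}_{SM}\therefore\mathbf{A}_{Sp}$; $\mathbf{A}_{MP},\mathbf{I}_{SM}\therefore\mathbf{I}_{SP}$; $\mathbf{A}_{Mp},\mathbf{I}_{SM}\therefore\mathbf{I}_{Sp}$; $\mathbf{A}_{Pm},\mathbf{A}_{SM}\therefore\mathbf{A}_{Sp}$; $\mathbf{A}_{PM},\mathbf{A}_{Sm}\therefore\mathbf{A}_{Sp}$; $\mathbf{A}_{Pm},\mathbf{I}_{SM}\therefore\mathbf{I}_{Sp}$; $\mathbf{A}_{PM},\mathbf{I}_{Sm}\therefore\mathbf{I}_{Sp}$;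 $\mathbf{I}_{MP},\mathbf{A}_{MS}\therefore\mathbf{I}_{SP}$; $\mathbf{A}_{MP},\mathbf{I}_{MS}\therefore\mathbf{I}_{SP}$; $\mathbf{I}_{Mp},\mathbf{A}_{MS}\therefore\mathbf{I}_{Sp}$; $\mathbf{A}_{Mp},\mathbf{I}_{MS}\therefore\mathbf{I}_{Sp}$; $\mathbf{A}_{PM},\mathbf{A}_{Ms}\therefore\mathbf{A}_{Sp}$; $\mathbf{I}_{PM},\mathbf{A}_{MS}\therefore\mathbf{I}_{SP}$; $\mathbf{A}_{Pm},\mathbf{I}_{MS}\therefore\mathbf{I}_{Sp}$. Strengthened syllogisms: $\mathbf{A}_{MP},\mathbf{A}_{SM},\mathbf{I}_{SS}\therefore\mathbf{I}_{SP}$; $\mathbf{A}_{Mp},\mathbf{A}_{SM},\mathbf{I}_{SS}\therefore\mathbf{I}_{Sp}$; $\mathbf{A}_{PM},\mathbf{A}_{Sm},\mathbf{I}_{SS}\therefore\mathbf{I}_{Sp}$; $\mathbf{A}_{Pm},\mathbf{A}_{SM},\mathbf{I}_{SS}\therefore\mathbf{I}_{Sp}$; $\mathbf{A}_{MP},\mathbf{A}_{MS},\mathbf{I}_{MM}\therefore\mathbf{I}_{SP}$; $\mathbf{A}_{Mp},\mathbf{A}_{MS},\mathbf{I}_{MM}\therefore\mathbf{I}_{Sp}$; $\mathbf{A}_{PM},\mathbf{A}_{Ms},\mathbf{I}_{SS}\therefore\mathbf{I}_{Sp}$; $\mathbf{A}_{Pm},\mathbf{A}_{MS},\mathbf{I}_{MM}\therefore\mathbf{I}_{Sp}$;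 $\mathbf{A}_{PM},\mathbf{A}_{MS},\mathbf{I}_{PP}\therefore\mathbf{I}_{SP}$. Translation $(\cdot)^{*}$ into categorical formulas, term-variables read as the atoms $S,M,P$: $\mathbf{A}_{AB}^{*}=A\multimap B$, $\mathbf{A}_{Ab}^{*}=A\multimap B^{\bot}$, $\mathbf{I}_{AB}^{*}=A\otimes B$, $\mathbf{I}_{Ab}^{*}=A\otimes B^{\bot}$ (so $\mathbf{I}_{XX}^{*}=X\otimes X$). *)

theory Defs
  imports "HOL-Library.Multiset"
begin

section \<open>Intuitionistic rudimentary linear logic\<close>

datatype 'a form =
    Atom 'a
  | Tensor "'a form" "'a form"  (infixr \<open>\<otimes>\<close> 75)
  | Lolli "'a form" "'a form"  (infixr \<open>\<multimap>\<close> 70)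

text \<open>
  The distinguished atom \<open>\<bottom>\<close> has no rules of its own, so the calculus does not mention it;
  it is an element \<open>falsum\<close> of the type of atoms and is passed as a parameter where it is used.
\<close>

inductive provable :: "'a form multiset \<Rightarrow> 'a form \<Rightarrow> bool"  (infix \<open>\<turnstile>\<close> 50) where
  Id: "{#A#} \<turnstile> A"
| TensorL: "\<Gamma> + {#A, B#} \<turnstile> C \<Longrightarrow> \<Gamma> + {#A \<otimes> B#} \<turnstile> C"
| TensorR: "\<Gamma> \<turnstile> A \<Longrightarrow> \<Delta> \<turnstile> B \<Longrightarrow> \<Gamma> + \<Delta> \<turnstile> A \<otimes> B"
| LolliL: "\<Gamma> \<turnstile> A \<Longrightarrow> \<Delta> + {#B#} \<turnstile> C \<Longrightarrow> \<Gamma> + \<Delta> + {#A \<multimap> B#} \<turnstile> C"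
| LolliR: "\<Gamma> + {#A#} \<turnstile> B \<Longrightarrow> \<Gamma> \<turnstile> A \<multimap> B"

abbreviation lin_neg :: "'a \<Rightarrow> 'a form \<Rightarrow> 'a form" where
  "lin_neg falsum A \<equiv> A \<multimap> Atom falsum"

section \<open>Traditional syllogistics\<close>

datatype tvar = S | M | P

text \<open>
  \<open>EachNon X Y\<close> is ``Each \<open>X\<close> is non-\<open>Y\<close>'', that is, the predicate is the
  complement of \<open>Y\<close>; likewise \<open>SomeNon\<close>.
\<close>

datatype catprop =
    EachIs (subj: tvar) (pred: tvar)
  | EachNon (subj: tvar) (pred: tvar)
  | SomeIs (subj: tvar) (pred: tvar)
  | SomeNon (subj: tvar) (pred: tvar)

definition tvars :: "catprop \<Rightarrow> tvar set" where
  "tvars Q = {subj Q, pred Q}"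

definition traditional_syllogism :: "catprop \<Rightarrow> catprop \<Rightarrow> catprop \<Rightarrow> bool" where
  "traditional_syllogism Q1 Q2 C \<longleftrightarrow>
     M \<in> tvars Q1 \<and> M \<in> tvars Q2 \<and> M \<notin> tvars C \<and>
     P \<in> tvars Q1 \<and> S \<in> tvars Q2 \<and> subj C = S \<and> pred C = P"

definition traditional_strengthened_syllogism ::
  "catprop \<Rightarrow> catprop \<Rightarrow> catprop \<Rightarrow> catprop \<Rightarrow> bool" where
  "traditional_strengthened_syllogism Q1 Q2 E C \<longleftrightarrow>
     traditional_syllogism Q1 Q2 C \<and> (\<exists>X \<in> {S, M, P}. E = SomeIs X X)"

text \<open>
  Validity is the traditional one, given by enumeration.
  It is not closed under adding premises.
\<close>

definition valid_syllogism :: "catprop \<Rightarrow> catprop \<Rightarrow> catprop \<Rightarrow> bool" where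
  "valid_syllogism Q1 Q2 C \<longleftrightarrow> (Q1, Q2, C) \<in> {
     (EachIs M P, EachIs S M, EachIs S P),
     (EachNon M P, EachIs S M, EachNon S P),
     (EachIs M P, SomeIs S M, SomeIs S P),
     (EachNon M P, SomeIs S M, SomeNon S P),
     (EachNon P M, EachIs S M, EachNon S P),
     (EachIs P M, EachNon S M, EachNon S P),
     (EachNon P M, SomeIs S M, SomeNon S P),
     (EachIs P M, SomeNon S M, SomeNon S P),
     (SomeIs M P, EachIs M S, SomeIs S P),
     (EachIs M P, SomeIs M S, SomeIs S P),
     (SomeNon M P, EachIs M S, SomeNon S P),
     (EachNon M P, SomeIs M S, SomeNon S P),
     (EachIs P M, EachNon M S, EachNon S P),
     (SomeIs P M, EachIs M S, SomeIs S P),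
     (EachNon P M, SomeIs M S, SomeNon S P)}"

definition valid_strengthened_syllogism ::
  "catprop \<Rightarrow> catprop \<Rightarrow> catprop \<Rightarrow> catprop \<Rightarrow> bool" where
  "valid_strengthened_syllogism Q1 Q2 E C \<longleftrightarrow> (Q1, Q2, E, C) \<in> {
     (EachIs M P, EachIs S M, SomeIs S S, SomeIs S P),
     (EachNon M P, EachIs S M, SomeIs S S, SomeNon S P),
     (EachIs P M, EachNon S M, SomeIs S S, SomeNon S P),
     (EachNon P M, EachIs S M, SomeIs S S, SomeNon S P),
     (EachIs M P, EachIs M S, SomeIs M M, SomeIs S P),
     (EachNon M P, EachIs M S, SomeIs M M, SomeNon S P),
     (EachIs P M, EachNon M S, SomeIs S S, SomeNon S P),
     (EachNon P M, EachIs M S, SomeIs M M, SomeNon S P),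
     (EachIs P M, EachIs M S, SomeIs P P, SomeIs S P)}"

section \<open>Translation\<close>

fun transl :: "'a \<Rightarrow> (tvar \<Rightarrow> 'a) \<Rightarrow> catprop \<Rightarrow> 'a form" where
  "transl falsum at (EachIs X Y) = Atom (at X) \<multimap> Atom (at Y)"
| "transl falsum at (EachNon X Y) = Atom (at X) \<multimap> lin_neg falsum (Atom (at Y))"
| "transl falsum at (SomeIs X Y) = Atom (at X) \<otimes> Atom (at Y)"
| "transl falsum at (SomeNon X Y) = Atom (at X) \<otimes> lin_neg falsum (Atom (at Y))"

end

theory Submission
  imports Defs
begin

text \<open>
  Without weakening and contraction, the signed number of occurrences of every atom is an invariant
  of provability. Among the syllogistic sequents this necessary condition is already sufficient:
  the arguments whose sequent is balanced are exactly the listed ones, and each of these has a short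
  cut-free proof.
\<close>

primrec balance :: "'a \<Rightarrow> 'a form \<Rightarrow> int" where
  "balance x (Atom y) = (if x = y then 1 else 0)"
| "balance x (A \<otimes> B) = balance x A + balance x B"
| "balance x (A \<multimap> B) = balance x B - balance x A"

text \<open>No rule discards or copies a formula. In \<open>LolliL\<close> the balances of
  \<open>A\<close> and \<open>B\<close> coming from the two premises cancel against that of the new
  implication.\<close>

lemma provable_balance:
  assumes "\<Gamma> \<turnstile> A"
  shows "(\<Sum>B\<in>#\<Gamma>. balance x B) = balance x A"
  using assms by induction auto

lemma provable_lolliR:
  assumes "add_mset A \<Gamma> \<turnstile> B"
  shows "\<Gamma> \<turnstile> A \<multimap> B"
  using assms LolliR[of \<Gamma> A B] by simp

lemma provable_lolliL:
  assumes "\<Gamma> \<turnstile> A" and "add_mset B \<Delta> \<turnstile> C"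
  shows "add_mset (A \<multimap> B) (\<Gamma> + \<Delta>) \<turnstile> C"
  using assms LolliL[of \<Gamma> A \<Delta> B C] by simp

lemma provable_tensorL:
  assumes "add_mset A (add_mset B \<Gamma>) \<turnstile> C"
  shows "add_mset (A \<otimes> B) \<Gamma> \<turnstile> C"
  using assms TensorL[of \<Gamma> A B C] by (simp add: add_mset_commute)

lemma provable_mp: "{#A, A \<multimap> B#} \<turnstile> B"
  using provable_lolliL[OF Id, of B "{#}" B A] by (simp add: Id add_mset_commute)

lemma provable_lolliL_Id:
  assumes "add_mset B \<Gamma> \<turnstile> C"
  shows "add_mset A (add_mset (A \<multimap> B) \<Gamma>) \<turnstile> C"
  using provable_lolliL[OF Id assms, of A] by (simp add: add_mset_commute)

lemma provable_mp_mp: "{#A, A \<multimap> B, B \<multimap> C#} \<turnstile> C"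
  by (intro provable_lolliL_Id Id)

lemma provable_lolli_trans: "{#A \<multimap> B, B \<multimap> C#} \<turnstile> A \<multimap> C"
  by (intro provable_lolliR provable_mp_mp)

text \<open>With \<open>Atom falsum\<close> for \<open>C\<close> this is contraposition of a
  negative premise.\<close>

lemma provable_lolli_swap: "{#A, B \<multimap> A \<multimap> C#} \<turnstile> B \<multimap> C"
proof -
  have "{#B, B \<multimap> A \<multimap> C, A#} \<turnstile> C"
    using provable_mp[of A C] by (intro provable_lolliL_Id) (simp add: add_mset_commute)
  then show ?thesis
    by (intro provable_lolliR) (simp add: add_mset_commute)
qed

lemma provable_mp_lolli_trans: "{#A, A \<multimap> B \<multimap> D, C \<multimap> B#} \<turnstile> C \<multimap> D"
  using provable_lolli_trans[of C B D] by (intro provable_lolliL_Id) (simp add: add_mset_commute)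

lemma provable_mp_lolli_swap: "{#A, A \<multimap> B, C \<multimap> B \<multimap> D#} \<turnstile> C \<multimap> D"
  by (intro provable_lolliL_Id provable_lolli_swap)

lemma provable_lolli_swap_trans: "{#A, C \<multimap> B, B \<multimap> A \<multimap> D#} \<turnstile> C \<multimap> D"
proof -
  have "{#C, C \<multimap> B, B \<multimap> A \<multimap> D, A#} \<turnstile> D"
    using provable_mp[of A D] by (intro provable_lolliL_Id) (simp add: add_mset_commute)
  then show ?thesis
    by (intro provable_lolliR) (simp add: add_mset_commute)
qed

text \<open>The tensor is functorial and commutative. The swapped form serves figures whose
  particular premise lists its terms in the order opposite to the conclusion.\<close>

lemma provable_tensor_map:
  assumes "add_mset A \<Gamma> \<turnstile> A'" and "add_mset B \<Delta> \<turnstile> B'"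
  shows "add_mset (A \<otimes> B) (\<Gamma> + \<Delta>) \<turnstile> A' \<otimes> B'"
    and "add_mset (B \<otimes> A) (\<Gamma> + \<Delta>) \<turnstile> A' \<otimes> B'"
  using TensorR[OF assms] by (auto intro!: provable_tensorL simp: add_mset_commute)

lemma provable_tensor_map_right:
  assumes "add_mset B \<Gamma> \<turnstile> B'"
  shows "add_mset (A \<otimes> B) \<Gamma> \<turnstile> A \<otimes> B'"
    and "add_mset (B \<otimes> A) \<Gamma> \<turnstile> A \<otimes> B'"
  using provable_tensor_map[OF Id assms] by simp_all

lemma provable_tensor_map_left:
  assumes "add_mset A \<Gamma> \<turnstile> A'"
  shows "add_mset (A \<otimes> B) \<Gamma> \<turnstile> A' \<otimes> B"
    and "add_mset (B \<otimes> A) \<Gamma> \<turnstile> A' \<otimes> B"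
  using provable_tensor_map[OF assms Id] by simp_all

text \<open>This and \<open>provable_tensor_mp_lolli_swap\<close> serve existential import on
  \<open>M\<close>: with \<open>A\<close> and \<open>B\<close> both \<open>M\<close>, each copy is
  spent on one of the two premises.\<close>

lemma provable_tensor_mp_mp: "{#A \<otimes> B, A \<multimap> A', B \<multimap> B'#} \<turnstile> A' \<otimes> B'"
  using provable_tensor_map(1)[OF provable_mp[of A A'] provable_mp[of B B']] by (simp add: add_mset_commute)

lemma provable_tensor_mp_lolli_swap:
  "{#A \<otimes> B, A \<multimap> A', C \<multimap> B \<multimap> D#} \<turnstile> A' \<otimes> (C \<multimap> D)"
  using provable_tensor_map(1)[OF provable_mp[of A A'] provable_lolli_swap[of B C D]]
  by (simp add: add_mset_commute)

lemmas provable_one_step = provable_mp provable_lolli_trans provable_lolli_swap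

lemmas provable_two_steps = provable_mp_mp provable_mp_lolli_trans provable_mp_lolli_swap
  provable_lolli_swap_trans provable_tensor_mp_mp provable_tensor_mp_lolli_swap

text \<open>Needed because \<open>rule\<close> matches the arguments of \<^const>\<open>add_mset\<close> in the written order.\<close>

lemma provable_exchange2: "{#B, A#} \<turnstile> C \<Longrightarrow> {#A, B#} \<turnstile> C"
  and provable_exchange3: "{#C, A, B#} \<turnstile> D \<Longrightarrow> {#A, B, C#} \<turnstile> D"
  and provable_exchange_tail: "{#A, C, B#} \<turnstile> D \<Longrightarrow> {#A, B, C#} \<turnstile> D"
  by (simp_all add: add_mset_commute)

lemma valid_syllogism_provable:
  assumes "valid_syllogism Q1 Q2 C"
  shows "{#transl falsum at Q1, transl falsum at Q2#} \<turnstile> transl falsum at C"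
  using assms unfolding valid_syllogism_def insert_iff empty_iff prod.inject
  \<comment> \<open>A universal conclusion is opened by \<open>provable_lolliR\<close>, which puts
    \<open>S\<close> first in the context. For a particular one, one factor of the particular
    premise passes unchanged and the universal premise acts on the other.\<close>
  by (elim disjE conjE FalseE; hypsubst; unfold transl.simps)
    (rule provable_lolliR, rule provable_two_steps
      | rule provable_lolliR, rule provable_exchange_tail, rule provable_two_steps
      | rule provable_tensor_map_right provable_tensor_map_left, rule provable_one_step
      | rule provable_exchange2, rule provable_tensor_map_right provable_tensor_map_left,
          rule provable_one_step
      | rule provable_exchange2, rule provable_tensor_map_right, rule provable_exchange2,
          rule provable_one_step)+

lemma valid_strengthened_syllogism_provable:
  assumes "valid_strengthened_syllogism Q1 Q2 E C"
  shows "{#transl falsum at Q1, transl falsum at Q2, transl falsum at E#} \<turnstile> transl falsum at C"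
  using assms unfolding valid_strengthened_syllogism_def insert_iff empty_iff prod.inject
  \<comment> \<open>The import formula comes to the front. On \<open>S\<close> or \<open>P\<close>,
    one of its two copies survives as a factor of the conclusion and the other is combined with both
    premises.\<close>
  by (elim disjE conjE FalseE; hypsubst; unfold transl.simps)
    (rule provable_exchange3,
      (rule provable_two_steps
      | rule provable_exchange_tail, rule provable_two_steps
      | rule provable_tensor_map_right provable_tensor_map_left, rule provable_two_steps
      | rule provable_exchange_tail, rule provable_tensor_map_right provable_tensor_map_left,
          rule provable_two_steps))+

text \<open>
  Taking \<^const>\<open>None\<close> for \<open>\<bottom>\<close> makes balance of a translation computable, independently of \<open>at\<close>.
\<close>

lemma balance_transl:
  assumes "distinct [at S, at M, at P, falsum]"
  shows "balance (case_option falsum at v) (transl falsum at Q) = balance v (transl None Some Q)"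
proof -
  have at: "at X = at Y \<longleftrightarrow> X = Y" "at X \<noteq> falsum" "falsum \<noteq> at X" for X Y
    using assms by (cases X; cases Y; auto)+
  show ?thesis by (cases Q; cases v) (simp_all add: at)
qed

text \<open>Two distinct term-variables must fill subject and predicate, so only their order and the
  form of the proposition stay free. Bounded quantifiers over explicit sets let \<open>simp\<close>
  unfold all 256 cases.\<close>

lemma traditional_syllogism_induct [consumes 1]:
  assumes "traditional_syllogism Q1 Q2 C"
    and "\<forall>Q1 \<in> {EachIs M P, EachIs P M, EachNon M P, EachNon P M,
                SomeIs M P, SomeIs P M, SomeNon M P, SomeNon P M}.
         \<forall>Q2 \<in> {EachIs M S, EachIs S M, EachNon M S, EachNon S M,
                SomeIs M S, SomeIs S M, SomeNon M S, SomeNon S M}.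
         \<forall>C \<in> {EachIs S P, EachNon S P, SomeIs S P, SomeNon S P}. R Q1 Q2 C"
  shows "R Q1 Q2 C"
proof -
  have "Q1 \<in> {EachIs M P, EachIs P M, EachNon M P, EachNon P M,
               SomeIs M P, SomeIs P M, SomeNon M P, SomeNon P M}"
    using assms(1) by (cases Q1) (auto simp: traditional_syllogism_def tvars_def)
  moreover have "Q2 \<in> {EachIs M S, EachIs S M, EachNon M S, EachNon S M,
                        SomeIs M S, SomeIs S M, SomeNon M S, SomeNon S M}"
    using assms(1) by (cases Q2) (auto simp: traditional_syllogism_def tvars_def)
  moreover have "C \<in> {EachIs S P, EachNon S P, SomeIs S P, SomeNon S P}"
    using assms(1) by (cases C) (auto simp: traditional_syllogism_def)
  ultimately show ?thesis
    by (rule assms(2)[rule_format])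
qed

lemma all_tvar_option:
  "(\<forall>v. R v) \<longleftrightarrow> R None \<and> R (Some S) \<and> R (Some M) \<and> R (Some P)"
  unfolding split_option_all using tvar.exhaust by metis

text \<open>A term counts -1 where it is distributed and +1 where it is not. So balance states
  classical rules: \<open>M\<close> is distributed in exactly one premise, \<open>S\<close> and
  \<open>P\<close> are distributed in the conclusion just as in their premise, and, at
  \<open>None\<close>, there are as many negative premises as negative conclusions.\<close>

lemma balanced_syllogism_valid:
  assumes "traditional_syllogism Q1 Q2 C"
  shows "(\<forall>v. balance v (transl None Some Q1) + balance v (transl None Some Q2)
            = balance v (transl None Some C)) \<longrightarrow> valid_syllogism Q1 Q2 C"
  using assms
  by (induction rule: traditional_syllogism_induct) (simp add: valid_syllogism_def all_tvar_option)

text \<open>The import adds 2 at \<open>X\<close>. This forces \<open>M\<close> to be distributed in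
  both premises if \<open>X\<close> is \<open>M\<close>; otherwise \<open>X\<close> is distributed
  in its premise but not in the conclusion.\<close>

lemma balanced_strengthened_syllogism_valid:
  assumes "traditional_syllogism Q1 Q2 C"
  shows "(\<forall>v. balance v (transl None Some Q1) + balance v (transl None Some Q2)
            + balance v (transl None Some (SomeIs X X)) = balance v (transl None Some C))
          \<longrightarrow> valid_strengthened_syllogism Q1 Q2 (SomeIs X X) C"
  using assms
  by (induction rule: traditional_syllogism_induct; cases X)
    (simp_all add: valid_strengthened_syllogism_def all_tvar_option)

theorem mainTheorem1:
  fixes falsum :: 'a and at :: "tvar \<Rightarrow> 'a"
  assumes "distinct [at S, at M, at P, falsum]"
  shows "(\<forall>Q1 Q2 C. traditional_syllogism Q1 Q2 C \<longrightarrow>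
            (valid_syllogism Q1 Q2 C \<longleftrightarrow>
             {#transl falsum at Q1, transl falsum at Q2#} \<turnstile> transl falsum at C))
       \<and> (\<forall>Q1 Q2 E C. traditional_strengthened_syllogism Q1 Q2 E C \<longrightarrow>
            (valid_strengthened_syllogism Q1 Q2 E C \<longleftrightarrow>
             {#transl falsum at Q1, transl falsum at Q2, transl falsum at E#} \<turnstile> transl falsum at C))"
proof (intro conjI allI impI iffI)
  fix Q1 Q2 C
  assume trad: "traditional_syllogism Q1 Q2 C"
    and prov: "{#transl falsum at Q1, transl falsum at Q2#} \<turnstile> transl falsum at C"
  have "\<forall>v. balance v (transl None Some Q1) + balance v (transl None Some Q2)
      = balance v (transl None Some C)"
    \<comment> \<open>As \<open>v\<close> varies, this names exactly the four atoms of the sequent's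
      vocabulary, with \<open>None\<close> standing for \<open>falsum\<close>.\<close>
    using provable_balance[OF prov, of "case_option falsum at v" for v]
    by (simp add: balance_transl[OF assms])
  with balanced_syllogism_valid[OF trad] show "valid_syllogism Q1 Q2 C" ..
next
  fix Q1 Q2 E C
  assume trad: "traditional_strengthened_syllogism Q1 Q2 E C"
    and prov: "{#transl falsum at Q1, transl falsum at Q2, transl falsum at E#} \<turnstile> transl falsum at C"
  obtain X where E: "E = SomeIs X X" and "traditional_syllogism Q1 Q2 C"
    using trad unfolding traditional_strengthened_syllogism_def by blast
  note balanced_strengthened_syllogism_valid[OF this(2), of X, folded E]
  moreover have "\<forall>v. balance v (transl None Some Q1) + balance v (transl None Some Q2)
      + balance v (transl None Some E) = balance v (transl None Some C)"
    using provable_balance[OF prov, of "case_option falsum at v" for v]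
    by (simp add: balance_transl[OF assms] add.assoc)
  ultimately show "valid_strengthened_syllogism Q1 Q2 E C" ..
qed (simp_all only: valid_syllogism_provable valid_strengthened_syllogism_provable)

end
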